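(* Let $d\ge2$, $\ell\ge1$, let $\mathbb E^{\ell d-1}\subset\mathbb R^{\ell d}$ be an $\ell$-block ellipsoid, and for $\rho>0$ let $K_\rho^d\subset\mathbb R^d$ be a cylinder of radius $\rho$ centered at the origin and $B_\rho^d\subset\mathbb R^d$ the ball of radius $\rho$ centered at the origin. Then 1. $|\mathbb E^{\ell d-1}\cap(K_\rho^d\times\mathbb R^{(\ell-1)d})|\lesssim\min\{1,\rho^{\frac{d-1}{2}}\}$; 2. $|\mathbb E^{\ell d-1}\cap(B_\rho^d\times\mathbb R^{(\ell-1)d})|\lesssim\min\{1,\rho^{\frac{d-1}{2}}\}$, where $|\cdot|$ is the surface measure on $\mathbb E^{\ell d-1}$ and the implicit constants depend on $d,\ell$ and the ellipsoid but not on $\rho$.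
   Context: An $\ell$-block ellipsoid is a set $\mathbb E^{\ell d-1}=\{\boldsymbol x\in\mathbb R^{\ell d}:\langle\boldsymbol x,A\boldsymbol x\rangle=c\}$ with $c>0$ and $A\in\mathbb R^{\ell d\times\ell d}$ a (symmetric) positive definite matrix of the block form $A=(a_{i,j}I_d)_{1\le i,j\le\ell}$, where $I_d$ is the $d\times d$ identity. A $d$-dimensional cylinder of radius $\rho$ centered at the origin is the set of points of $\mathbb R^d$ at distance at most $\rho$ from some line through the origin. *)

theory Defs
  imports "HOL-Analysis.Analysis"
begin

text \<open>
  The surface measure on a hypersurface of \<open>\<real>\<^sup>n\<close> is the \<open>(n-1)\<close>-dimensional Hausdorff measure,
  with the normalisation under which the \<open>m\<close>-dimensional Hausdorff measure agrees with Lebesgue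
  measure on \<open>\<real>\<^sup>m\<close>. It is defined as an outer measure on all sets. Covering sets must be explicitly
  bounded, as \<^const>\<open>diameter\<close> is unspecified on unbounded sets; empty covering sets contribute
  nothing even when \<open>m = 0\<close>.
\<close>

definition hausdorff_content :: "nat \<Rightarrow> real \<Rightarrow> 'a::metric_space set \<Rightarrow> ennreal" where
  "hausdorff_content m \<delta> S =
    (INF U \<in> {U :: nat \<Rightarrow> 'a set. S \<subseteq> (\<Union>i. U i) \<and> (\<forall>i. bounded (U i) \<and> diameter (U i) \<le> \<delta>)}.
      \<Sum>i. if U i = {} then 0 else ennreal (unit_ball_vol (real m) * (diameter (U i) / 2) ^ m))"

definition hausdorff_measure :: "nat \<Rightarrow> 'a::metric_space set \<Rightarrow> ennreal" where
  "hausdorff_measure m S = (SUP \<delta> \<in> {0<..}. hausdorff_content m \<delta> S)"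

definition positive_definite :: "real^'n^'n \<Rightarrow> bool" where
  "positive_definite A \<longleftrightarrow> transpose A = A \<and> (\<forall>x. x \<noteq> 0 \<longrightarrow> x \<bullet> (A *v x) > 0)"

text \<open>
  \<open>\<real>\<^bsup>\<ell>d\<^esup>\<close> is rendered as \<^typ>\<open>real^('l::finite \<times> 'd::finite)\<close> with \<open>\<ell> = CARD('l)\<close> and \<open>d = CARD('d)\<close>; the
  coordinate \<open>(i, p)\<close> is the \<open>p\<close>-th coordinate of the \<open>i\<close>-th block.
\<close>

definition scalar_block_matrix :: "real^'l::finite^'l \<Rightarrow> real^('l \<times> 'd::finite)^('l \<times> 'd)" where
  "scalar_block_matrix a = (\<chi> r s. a $ fst r $ fst s * (mat 1 :: real^'d^'d) $ snd r $ snd s)"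

definition block_ellipsoid :: "(real^('l::finite \<times> 'd::finite)) set \<Rightarrow> bool" where
  "block_ellipsoid E \<longleftrightarrow>
    (\<exists>A c. c > 0 \<and> positive_definite A \<and> (\<exists>a. A = scalar_block_matrix a) \<and>
      E = {x. x \<bullet> (A *v x) = c})"

definition cylinder :: "real \<Rightarrow> 'a::euclidean_space set \<Rightarrow> bool" where
  "cylinder \<rho> K \<longleftrightarrow> (\<exists>L. subspace L \<and> dim L = 1 \<and> K = {x. infdist x L \<le> \<rho>})"

definition block :: "'l::finite \<Rightarrow> real^('l \<times> 'd::finite) \<Rightarrow> real^'d" where
  "block i x = (\<chi> p. x $ (i, p))"

text \<open>
  The set \<open>S \<times> \<real>\<^bsup>(\<ell>-1)d\<^esup>\<close>. The index type carries no order, so the block that has to lie in \<open>S\<close>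
  (the first one, up to relabelling) is given by its index.
\<close>

definition block_product :: "'l::finite \<Rightarrow> (real^'d::finite) set \<Rightarrow> (real^('l \<times> 'd)) set" where
  "block_product i S = {x. block i x \<in> S}"

end

theory Submission
  imports Defs
begin

text \<open>
  The \<open>(n - 1)\<close>-dimensional Hausdorff measure of a set is at most a constant times \<open>1 / \<epsilon>\<close> times the
  volume of its \<open>\<epsilon>\<close>-neighbourhood, for small \<open>\<epsilon>\<close>. For the piece of the ellipsoid \<open>Q = c\<close> over a
  cylinder of radius \<open>\<rho>\<close>, that neighbourhood lies in a shell \<open>\<bar>Q - c\<bar> \<le> h\<close>, with \<open>h\<close> comparable to \<open>\<epsilon>\<close>,
  over the cylinder of radius \<open>2 * \<rho>\<close>. As cylinders are star-shaped and \<open>Q\<close> is homogeneous, the volume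
  of this part of the shell is \<open>O(h)\<close> times that of the part of the solid ellipsoid over the same
  cylinder, which is \<open>O(min 1 (\<rho> ^ (d - 1)))\<close>.
\<close>

section \<open>Hausdorff measure and volumes of neighbourhoods\<close>

lemma hausdorff_measure_mono:
  assumes "S \<subseteq> T"
  shows "hausdorff_measure m S \<le> hausdorff_measure m T"
  unfolding hausdorff_measure_def hausdorff_content_def
  by (rule SUP_mono', rule INF_superset_mono) (use assms in auto)

text \<open>Enumerate the balls as the first \<open>card F\<close> sets of a countable cover and pad
  with empty sets, which contribute nothing. Each ball has diameter exactly
  \<open>2 * \<epsilon>\<close>, so it is admissible at scale \<open>\<delta>\<close>.\<close>

lemma hausdorff_content_le_card_cballs:
  fixes F :: "'a::euclidean_space set"
  assumes "finite F" "S \<subseteq> (\<Union>x\<in>F. cball x \<epsilon>)" "0 < \<epsilon>" "2 * \<epsilon> \<le> \<delta>"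
  shows "hausdorff_content m \<delta> S \<le> ennreal (real (card F) * (unit_ball_vol (real m) * \<epsilon> ^ m))"
proof -
  obtain f where f: "bij_betw f {0..<card F} F"
    using ex_bij_betw_nat_finite[OF assms(1)] by auto
  define U where "U i = (if i < card F then cball (f i) \<epsilon> else {})" for i
  have cov: "S \<subseteq> (\<Union>i. U i)"
  proof
    fix x assume "x \<in> S"
    then obtain y where "y \<in> F" "x \<in> cball y \<epsilon>" using assms(2) by blast
    moreover from this obtain i where "i < card F" "f i = y"
      using f unfolding bij_betw_def by (metis atLeastLessThan_iff imageE)
    ultimately show "x \<in> (\<Union>i. U i)" by (auto simp: U_def intro!: exI[of _ i])
  qed
  have "hausdorff_content m \<delta> S
    \<le> (\<Sum>i. if U i = {} then 0 else ennreal (unit_ball_vol (real m) * (diameter (U i) / 2) ^ m))"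
    unfolding hausdorff_content_def
    by (rule INF_lower) (use cov assms in \<open>auto simp: U_def\<close>)
  also have "\<dots> = (\<Sum>i. if i \<in> {..<card F} then ennreal (unit_ball_vol (real m) * \<epsilon> ^ m) else 0)"
    using assms(3) by (intro suminf_cong) (auto simp: U_def)
  also have "\<dots> = (\<Sum>i<card F. ennreal (unit_ball_vol (real m) * \<epsilon> ^ m))"
    by (subst suminf_finite[of "{..<card F}"]) auto
  also have "\<dots> = ennreal (real (card F) * (unit_ball_vol (real m) * \<epsilon> ^ m))"
    using assms(3) by (simp add: ennreal_of_nat_eq_real_of_nat ennreal_mult)
  finally show ?thesis .
qed

text \<open>The balls of radius \<open>\<epsilon> / 2\<close> about the separated points are
  pairwise disjoint and lie in \<open>T\<close>, so their volumes add up to at most that of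
  \<open>T\<close>.\<close>

lemma card_separated_le_measure:
  fixes F :: "'a::euclidean_space set"
  assumes "finite F" and sep: "pairwise (\<lambda>x y. \<epsilon> \<le> dist x y) F" and "0 < \<epsilon>"
    and T: "T \<in> lmeasurable" "\<And>x. x \<in> F \<Longrightarrow> cball x \<epsilon> \<subseteq> T"
  shows "real (card F) * (unit_ball_vol (real DIM('a)) * (\<epsilon> / 2) ^ DIM('a)) \<le> measure lebesgue T"
proof -
  have "disjoint_family_on (\<lambda>x. ball x (\<epsilon> / 2)) F"
    unfolding disjoint_family_on_def
  proof (intro ballI impI equals0I)
    fix x y z assume "x \<in> F" "y \<in> F" "x \<noteq> y" and z: "z \<in> ball x (\<epsilon> / 2) \<inter> ball y (\<epsilon> / 2)"
    then have "\<epsilon> \<le> dist x y" using sep by (auto simp: pairwise_def)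
    with z show False
      using dist_triangle2[of x y z] by (simp add: dist_commute)
  qed
  then have "measure lebesgue (\<Union>x\<in>F. ball x (\<epsilon> / 2)) = (\<Sum>x\<in>F. measure lebesgue (ball x (\<epsilon> / 2)))"
    using assms(1) by (intro measure_finite_Union) 
      (auto simp: fmeasurableD fmeasurableD2[OF lmeasurable_ball] simp del: emeasure_completion)
  also have "\<dots> = real (card F) * (unit_ball_vol (real DIM('a)) * (\<epsilon> / 2) ^ DIM('a))"
    using assms(3) by (simp add: content_ball)
  finally have eq: "measure lebesgue (\<Union>x\<in>F. ball x (\<epsilon> / 2))
     = real (card F) * (unit_ball_vol (real DIM('a)) * (\<epsilon> / 2) ^ DIM('a))" .
  have "(\<Union>x\<in>F. ball x (\<epsilon> / 2)) \<subseteq> T"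
    using T(2) \<open>0 < \<epsilon>\<close> by (force simp: subset_iff)
  then have "measure lebesgue (\<Union>x\<in>F. ball x (\<epsilon> / 2)) \<le> measure lebesgue T"
    by (rule measure_mono_fmeasurable) (use T assms in auto)
  with eq show ?thesis by simp
qed

text \<open>The packing bound limits the size of \<open>\<epsilon>\<close>-separated subsets of
  \<open>S\<close>, so one of maximal cardinality exists. A point of \<open>S\<close> that it leaves
  uncovered could be added to it, hence it is a net.\<close>

lemma ex_finite_separated_net:
  fixes S :: "'a::euclidean_space set"
  assumes "0 < \<epsilon>" and T: "T \<in> lmeasurable" "\<And>x. x \<in> S \<Longrightarrow> cball x \<epsilon> \<subseteq> T"
  obtains F where "finite F" "S \<subseteq> (\<Union>x\<in>F. cball x \<epsilon>)"
    "real (card F) * (unit_ball_vol (real DIM('a)) * (\<epsilon> / 2) ^ DIM('a)) \<le> measure lebesgue T"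
proof -
  define P where "P F \<longleftrightarrow> finite F \<and> F \<subseteq> S \<and> pairwise (\<lambda>x y. \<epsilon> \<le> dist x y) F" for F
  define v where "v = unit_ball_vol (real DIM('a)) * (\<epsilon> / 2) ^ DIM('a)"
  have "v > 0" using assms(1) by (simp add: v_def)
  have bound: "real (card F) * v \<le> measure lebesgue T" if "P F" for F
    using that assms unfolding P_def v_def by (intro card_separated_le_measure) auto
  have "\<exists>F. P F \<and> (\<forall>G. P G \<longrightarrow> card G \<le> card F)"
  proof (rule Lattices_Big.ex_has_greatest_nat)
    show "P {}" by (simp add: P_def)
    \<comment> \<open>The existence of a maximum is derived from a strict upper bound, hence the
      successor of the floor.\<close>
    show "\<forall>G. P G \<longrightarrow> card G < Suc (nat \<lfloor>measure lebesgue T / v\<rfloor>)"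
      using bound \<open>v > 0\<close> by (auto simp: less_Suc_eq_le le_nat_floor pos_le_divide_eq)
  qed
  then obtain F where F: "P F" and max: "\<And>G. P G \<Longrightarrow> card G \<le> card F" by blast
  have "S \<subseteq> (\<Union>x\<in>F. cball x \<epsilon>)"
  proof (rule ccontr)
    assume "\<not> ?thesis"
    then obtain y where "y \<in> S" "y \<notin> (\<Union>x\<in>F. cball x \<epsilon>)" by blast
    then have y: "y \<in> S" "\<And>x. x \<in> F \<Longrightarrow> \<epsilon> < dist x y" by (auto simp: not_le)
    then have "P (insert y F)"
      using F by (auto simp: P_def pairwise_insert dist_commute intro: less_imp_le)
    moreover have "y \<notin> F" using y(2) assms(1) by force
    ultimately show False using max[of "insert y F"] F by (simp add: P_def)
  qed
  moreover have "finite F" using F by (simp add: P_def)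
  ultimately show thesis using bound[OF F] unfolding v_def by (intro that)
qed

text \<open>With \<open>n = DIM('a)\<close>, a net of \<open>S\<close> at scale
  \<open>\<epsilon>\<close> has O(\<open>B * \<epsilon> / \<epsilon> ^ n\<close>) points, so the
  \<open>(n - 1)\<close>-dimensional content of the cover by its balls is O(\<open>B\<close>). This
  bound is free of \<open>\<epsilon>\<close> and therefore survives the supremum over
  \<open>\<delta>\<close>.\<close>

lemma hausdorff_measure_le_neighbourhood_volume:
  fixes S :: "'a::euclidean_space set"
  assumes "0 < \<epsilon>\<^sub>0"
    and T: "\<And>\<epsilon>. 0 < \<epsilon> \<Longrightarrow> \<epsilon> \<le> \<epsilon>\<^sub>0 \<Longrightarrow>
      \<exists>T\<in>lmeasurable. (\<forall>x\<in>S. cball x \<epsilon> \<subseteq> T) \<and> measure lebesgue T \<le> B * \<epsilon>"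
  shows "hausdorff_measure (DIM('a) - 1) S
    \<le> ennreal (2 ^ DIM('a) * unit_ball_vol (real (DIM('a) - 1)) / unit_ball_vol (real DIM('a)) * B)"
  unfolding hausdorff_measure_def
proof (rule SUP_least)
  fix \<delta> :: real assume "\<delta> \<in> {0<..}"
  define \<epsilon> where "\<epsilon> = min \<epsilon>\<^sub>0 (\<delta> / 2)"
  have \<epsilon>: "0 < \<epsilon>" "\<epsilon> \<le> \<epsilon>\<^sub>0" "2 * \<epsilon> \<le> \<delta>" using \<open>\<delta> \<in> _\<close> assms(1) by (auto simp: \<epsilon>_def)
  obtain T where T: "T \<in> lmeasurable" "\<And>x. x \<in> S \<Longrightarrow> cball x \<epsilon> \<subseteq> T" "measure lebesgue T \<le> B * \<epsilon>"
    using T[OF \<epsilon>(1,2)] by blast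
  obtain F where F: "finite F" "S \<subseteq> (\<Union>x\<in>F. cball x \<epsilon>)"
    "real (card F) * (unit_ball_vol (real DIM('a)) * (\<epsilon> / 2) ^ DIM('a)) \<le> measure lebesgue T"
    using ex_finite_separated_net[OF \<epsilon>(1) T(1,2)] by blast
  let ?v = "unit_ball_vol (real DIM('a))" and ?w = "unit_ball_vol (real (DIM('a) - 1))"
  have v: "?v > 0" "?w > 0" by simp_all
  have pow: "\<epsilon> ^ DIM('a) = \<epsilon> * \<epsilon> ^ (DIM('a) - 1)"
    by (rule power_eq_if[THEN trans]) simp
  \<comment> \<open>The packing bound has \<open>\<epsilon> ^ DIM('a)\<close> on the left and the
    volume bound has \<open>\<epsilon>\<close> on the right. One factor cancels and leaves the power
    that occurs in the content.\<close>
  have "\<epsilon> * (real (card F) * \<epsilon> ^ (DIM('a) - 1) * ?v) \<le> \<epsilon> * (2 ^ DIM('a) * B)"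
    using order_trans[OF F(3) T(3)] by (simp add: power_divide pow field_simps)
  then have "real (card F) * \<epsilon> ^ (DIM('a) - 1) * ?v \<le> 2 ^ DIM('a) * B"
    using \<epsilon>(1) by simp
  then have "real (card F) * \<epsilon> ^ (DIM('a) - 1) \<le> 2 ^ DIM('a) * B / ?v"
    using v by (simp add: pos_le_divide_eq)
  then have "?w * (real (card F) * \<epsilon> ^ (DIM('a) - 1)) \<le> ?w * (2 ^ DIM('a) * B / ?v)"
    using v(2) by (intro mult_left_mono) auto
  then have "real (card F) * (?w * \<epsilon> ^ (DIM('a) - 1)) \<le> 2 ^ DIM('a) * ?w / ?v * B"
    by (simp add: mult_ac)
  with hausdorff_content_le_card_cballs[OF F(1,2) \<epsilon>(1,3), of "DIM('a) - 1"]
  show "hausdorff_content (DIM('a) - 1) \<delta> S \<le> ennreal (2 ^ DIM('a) * ?w / ?v * B)"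
    by (meson ennreal_leI order_trans)
qed

section \<open>Volume of thin shells\<close>

text \<open>A linear upper bound for the power, by induction using \<open>x * x \<le> x\<close>. It
  turns the ratio of the volumes of two nearby sublevel sets into 1 + O(\<open>h\<close>).\<close>

lemma one_plus_power_le:
  fixes x :: real
  assumes "0 \<le> x" "x \<le> 1"
  shows "(1 + x) ^ n \<le> 1 + 3 ^ n * x"
proof (induction n)
  case (Suc n)
  have "(1 + x) ^ Suc n \<le> (1 + 3 ^ n * x) * (1 + x)"
    using Suc assms by (simp add: mult_left_mono mult.commute)
  also have "\<dots> = 1 + x + 3 ^ n * x + 3 ^ n * (x * x)" by (simp add: algebra_simps)
  also have "3 ^ n * (x * x) \<le> 3 ^ n * x" using assms by (simp add: mult_left_le)
  finally have "(1 + x) ^ Suc n \<le> 1 + x + 3 ^ n * x + 3 ^ n * x" by simp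
  moreover have "1 * x \<le> 3 ^ n * x" using assms by (intro mult_right_mono) auto
  moreover have "1 + 3 ^ Suc n * x = 1 + 3 ^ n * x + 3 ^ n * x + 3 ^ n * x" by simp
  ultimately show ?case by linarith
qed (use assms in simp)

text \<open>
  Shrinking by the factor \<open>(c - h) / (c + h)\<close> maps the part of \<open>S\<close> inside the larger level set into
  the part inside the smaller one, so the shell has at most \<open>O(h)\<close> times the volume of the latter.
\<close>

lemma measure_shell_le:
  fixes Q :: "'a::euclidean_space \<Rightarrow> real"
  assumes Q: "continuous_on UNIV Q" "\<And>t x. Q (t *\<^sub>R x) = t\<^sup>2 * Q x"
    and bdd: "\<And>s. bounded {x. Q x \<le> s}"
    and S: "closed S" "\<And>t x. x \<in> S \<Longrightarrow> 0 \<le> t \<Longrightarrow> t \<le> 1 \<Longrightarrow> t *\<^sub>R x \<in> S"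
    and h: "0 < h" "4 * h \<le> c"
  shows "{x \<in> S. c - h < Q x \<and> Q x \<le> c + h} \<in> lmeasurable"
    and "measure lebesgue {x \<in> S. c - h < Q x \<and> Q x \<le> c + h}
    \<le> 3 ^ DIM('a) * (4 * h / c) * measure lebesgue {x \<in> S. Q x \<le> c}"
proof -
  define V where "V s = {x \<in> S. Q x \<le> s}" for s
  have Vcompact: "compact (V s)" for s
  proof -
    have "closed {x. Q x \<le> s}" using Q(1) by (intro closed_Collect_le) auto
    then show ?thesis
      using S(1) bdd[of s] unfolding V_def compact_eq_bounded_closed
      by (auto simp: Collect_conj_eq intro: bounded_subset)
  qed
  then have V: "V s \<in> lmeasurable" for s by (rule lmeasurable_compact)
  have Vmono: "measure lebesgue (V s) \<le> measure lebesgue (V t)" if "s \<le> t" for s t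
    by (rule measure_mono_fmeasurable) (use that V in \<open>auto simp: V_def\<close>)
  define t where "t = (c - h) / (c + h)"
  have t: "0 < t" "t \<le> 1" using h by (auto simp: t_def field_simps)
  \<comment> \<open>The quadratic form scales by \<open>t\<^sup>2\<close>. As
    \<open>t \<le> 1\<close>, the simpler ratio \<open>t\<close> itself already shrinks enough, and
    no square root is taken.\<close>
  have "t * t * (c + h) \<le> 1 * t * (c + h)" using t h by (intro mult_right_mono) auto
  also have "\<dots> = c - h" using h by (simp add: t_def)
  finally have tt: "t\<^sup>2 * (c + h) \<le> c - h" by (simp add: power2_eq_square)
  have "(*\<^sub>R) t ` V (c + h) \<subseteq> V (c - h)"
  proof
    fix y assume "y \<in> (*\<^sub>R) t ` V (c + h)"
    then obtain x where x: "x \<in> S" "Q x \<le> c + h" "y = t *\<^sub>R x" by (auto simp: V_def)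
    have "t\<^sup>2 * Q x \<le> t\<^sup>2 * (c + h)" using x by (simp add: mult_left_mono)
    then have "t\<^sup>2 * Q x \<le> c - h" using tt by linarith
    then show "y \<in> V (c - h)" using x t S(2) Q(2) by (auto simp: V_def)
  qed
  then have "measure lebesgue ((*\<^sub>R) t ` V (c + h)) \<le> measure lebesgue (V (c - h))"
    by (rule measure_mono_fmeasurable) 
      (use V Vcompact in \<open>auto intro!: fmeasurableD lmeasurable_compact compact_scaling\<close>)
  then have "t ^ DIM('a) * measure lebesgue (V (c + h)) \<le> measure lebesgue (V (c - h))"
    using t measure_lebesgue_affine[of t 0 "V (c + h)"] by simp
  then have "measure lebesgue (V (c + h)) \<le> (1 / t) ^ DIM('a) * measure lebesgue (V (c - h))"
    using t by (simp add: field_simps)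
  also have "(1 / t) ^ DIM('a) \<le> (1 + 4 * h / c) ^ DIM('a)"
  proof (rule power_mono)
    \<comment> \<open>The two sides differ by \<open>h * (2 * c - 4 * h)\<close>.\<close>
    have "(c + h) * c \<le> (c - h) * (c + 4 * h)"
      using mult_nonneg_nonneg[of h "2 * c - 4 * h"] h by (simp add: algebra_simps)
    then show "1 / t \<le> 1 + 4 * h / c" using h by (simp add: t_def field_simps)
  qed (use t in auto)
  also have "(1 + 4 * h / c) ^ DIM('a) \<le> 1 + 3 ^ DIM('a) * (4 * h / c)"
    using h by (intro one_plus_power_le) auto
  finally have "measure lebesgue (V (c + h)) - measure lebesgue (V (c - h))
      \<le> 3 ^ DIM('a) * (4 * h / c) * measure lebesgue (V (c - h))"
    by (simp add: mult_right_mono algebra_simps)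
  also have "\<dots> \<le> 3 ^ DIM('a) * (4 * h / c) * measure lebesgue (V c)"
    using h by (intro mult_left_mono Vmono) auto
  finally have "measure lebesgue (V (c + h)) - measure lebesgue (V (c - h))
    \<le> 3 ^ DIM('a) * (4 * h / c) * measure lebesgue (V c)" .
  \<comment> \<open>The strict lower inequality in the shell makes it exactly a difference of two
    compact sublevel sets.\<close>
  moreover have shell: "{x \<in> S. c - h < Q x \<and> Q x \<le> c + h} = V (c + h) - V (c - h)"
    by (auto simp: V_def)
  moreover have "measure lebesgue (V (c + h) - V (c - h))
      = measure lebesgue (V (c + h)) - measure lebesgue (V (c - h))"
    using h V by (intro measurable_measure_Diff) (auto simp: V_def fmeasurableD)
  ultimately show "measure lebesgue {x \<in> S. c - h < Q x \<and> Q x \<le> c + h}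
    \<le> 3 ^ DIM('a) * (4 * h / c) * measure lebesgue {x \<in> S. Q x \<le> c}"
    by (simp add: V_def)
  show "{x \<in> S. c - h < Q x \<and> Q x \<le> c + h} \<in> lmeasurable"
    unfolding shell using V by (intro fmeasurable.Diff)
qed

section \<open>Lines and distances to them\<close>

lemma line_eq_range_unit:
  fixes L :: "'a::euclidean_space set"
  assumes "subspace L" "dim L = 1"
  obtains v where "norm v = 1" "L = range (\<lambda>t. t *\<^sub>R v)"
proof -
  obtain B where B: "\<And>x. x \<in> B \<Longrightarrow> norm x = 1" "card B = dim L" "span B = L"
    using orthonormal_basis_subspace[OF assms(1)] by metis
  then obtain v where "B = {v}" using assms(2) by (metis card_1_singletonE)
  with B show thesis using that[of v] by (auto simp: span_singleton)
qed

lemma infdist_subspace_attained: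
  fixes L :: "'a::euclidean_space set"
  assumes "subspace L"
  obtains a where "a \<in> L" "infdist x L = dist x a"
  using infdist_attains_inf[of L x] closed_subspace[OF assms] subspace_0[OF assms] by blast

text \<open>Scaling the nearest point along with \<open>x\<close> keeps it in \<open>L\<close>. This
  makes cylinders star-shaped about the origin, as the shell estimate requires.\<close>

lemma infdist_subspace_scaleR_le:
  fixes L :: "'a::euclidean_space set"
  assumes "subspace L" "0 \<le> t" "t \<le> 1"
  shows "infdist (t *\<^sub>R x) L \<le> infdist x L"
proof -
  obtain a where a: "a \<in> L" "infdist x L = dist x a"
    using infdist_subspace_attained[OF assms(1)] .
  have "infdist (t *\<^sub>R x) L \<le> dist (t *\<^sub>R x) (t *\<^sub>R a)"
    using a assms(1) by (intro infdist_le) (simp add: subspace_scale)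
  also have "\<dots> = t * dist x a"
    using assms(2) by (simp add: dist_norm flip: scaleR_diff_right)
  also have "\<dots> \<le> infdist x L"
    using a assms by (simp add: mult_left_le_one_le)
  finally show ?thesis .
qed

section \<open>Block projections and the volume of truncated cylinders\<close>

lemma linear_block: "linear (block k)"
  by (auto simp: block_def vec_eq_iff intro!: linearI)

lemma norm_block_le: "norm (block k x) \<le> norm x"
proof -
  have "(\<Sum>p\<in>UNIV. (x $ (k, p))\<^sup>2) = (\<Sum>i\<in>Pair k ` UNIV. (x $ i)\<^sup>2)"
    by (subst sum.reindex) (auto simp: inj_on_def)
  also have "\<dots> \<le> (\<Sum>i\<in>UNIV. (x $ i)\<^sup>2)" by (intro sum_mono2) auto
  finally show ?thesis by (simp add: norm_vec_def L2_set_def block_def)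
qed

lemma dist_block_le: "dist (block k x) (block k y) \<le> dist x y"
  using norm_block_le[of k "x - y"] by (simp add: dist_norm linear_diff[OF linear_block])

lemma closed_block_cylinder: "closed {x. infdist (block k x) L \<le> r}"
proof -
  have "continuous_on UNIV (block k)" 
    by (rule linear_continuous_on[OF linear_block[unfolded linear_conv_bounded_linear]])
  then show ?thesis by (intro closed_Collect_le continuous_intros)
qed

text \<open>Boxes of side \<open>4 * r\<close> around the points \<open>j * r * v\<close> of the axis cover the truncated cylinder.\<close>

lemma measure_block_cylinder_le:
  fixes k :: "'l::finite" and L :: "(real^'d::finite) set"
  assumes L: "subspace L" "dim L = 1" and r: "0 < r" "r \<le> 1" and "0 \<le> R"
  shows "measure lebesgue {x. norm x \<le> R \<and> infdist (block k x) L \<le> r}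
    \<le> (2 * R + 5) * 4 ^ CARD('d) * (2 * R) ^ card {i::'l \<times> 'd. fst i \<noteq> k} * r ^ (CARD('d) - 1)"
    (is "measure _ ?W \<le> _")
proof -
  obtain v where v: "norm v = 1" "L = range (\<lambda>t. t *\<^sub>R v)"
    using line_eq_range_unit[OF L] .
  \<comment> \<open>The axis point \<open>t *\<^sub>R v\<close> near a point of the set has
    \<open>\<bar>t\<bar> \<le> R + r \<le> R + 1\<close>, so rounding \<open>t / r\<close> down
    gives an index between \<open>- N\<close> and \<open>N\<close>.\<close>
  define N where "N = \<lceil>(R + 1) / r\<rceil>"
  define lo :: "int \<Rightarrow> real^('l \<times> 'd)"
    where "lo j = (\<chi> i. if fst i = k then j * r * v $ snd i - 2 * r else - R)" for j
  define hi :: "int \<Rightarrow> real^('l \<times> 'd)"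
    where "hi j = (\<chi> i. if fst i = k then j * r * v $ snd i + 2 * r else R)" for j
  have cover: "?W \<subseteq> (\<Union>j\<in>{-N..N}. cbox (lo j) (hi j))"
  proof
    fix x assume x: "x \<in> ?W"
    obtain a where "a \<in> L" "infdist (block k x) L = dist (block k x) a"
      using infdist_subspace_attained[OF L(1)] .
    with x v obtain t where t: "dist (block k x) (t *\<^sub>R v) \<le> r" by auto
    have "\<bar>t\<bar> = norm (t *\<^sub>R v)" using v by simp
    also have "\<dots> \<le> norm (block k x) + dist (block k x) (t *\<^sub>R v)"
      by (metis dist_commute dist_norm norm_triangle_sub)
    also have "\<dots> \<le> R + 1" using x t r norm_block_le[of k x] by auto
    finally have "\<bar>t / r\<bar> \<le> (R + 1) / r" using r by (simp add: divide_right_mono)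
    then have tN: "\<bar>t / r\<bar> \<le> of_int N" unfolding N_def by linarith
    define j where "j = \<lfloor>t / r\<rfloor>"
    have j: "j \<in> {-N..N}"
      using tN unfolding j_def atLeastAtMost_iff abs_le_iff by linarith
    have "\<bar>t / r - j\<bar> \<le> 1" unfolding j_def by linarith
    moreover have "t - j * r = (t / r - j) * r" using r by (simp add: field_simps)
    ultimately have tj: "\<bar>t - j * r\<bar> \<le> r"
      using r by (simp add: abs_mult)
    \<comment> \<open>One \<open>r\<close> comes from the distance to the axis, the other from
      rounding the axis parameter to a multiple of \<open>r\<close>.\<close>
    have "\<bar>x $ (k, p) - j * r * v $ p\<bar> \<le> 2 * r" for p
    proof -
      have "\<bar>x $ (k, p) - t * v $ p\<bar> \<le> r"
        using t component_le_norm_cart[of "block k x - t *\<^sub>R v" p] by (simp add: dist_norm block_def)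
      moreover have "\<bar>t * v $ p - j * r * v $ p\<bar> \<le> r * 1"
        unfolding left_diff_distrib[symmetric] abs_mult
        using tj v component_le_norm_cart[of v p] r by (intro mult_mono) auto
      ultimately show ?thesis by linarith
    qed
    moreover have "x $ i \<le> R \<and> - R \<le> x $ i" for i
      using component_le_norm_cart[of x i] x by auto
    ultimately have "x \<in> cbox (lo j) (hi j)"
      by (auto simp: mem_box_cart lo_def hi_def abs_le_iff algebra_simps)
    with j show "x \<in> (\<Union>j\<in>{-N..N}. cbox (lo j) (hi j))" by blast
  qed
  have box: "measure lebesgue (cbox (lo j) (hi j))
      = (4 * r) ^ CARD('d) * (2 * R) ^ card {i::'l \<times> 'd. fst i \<noteq> k}" for j
  proof -
    have "{i::'l \<times> 'd. fst i = k} = Pair k ` UNIV" by auto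
    then have card: "card {i::'l \<times> 'd. fst i = k} = CARD('d)"
      by (simp add: card_image inj_on_def)
    have "\<And>i. lo j $ i \<le> hi j $ i" using r assms(5) by (auto simp: lo_def hi_def)
    then have "cbox (lo j) (hi j) \<noteq> {}" by (auto simp: interval_ne_empty_cart)
    then have "measure lebesgue (cbox (lo j) (hi j)) = (\<Prod>i\<in>UNIV. hi j $ i - lo j $ i)"
      by (simp add: content_cbox_cart)
    also have "\<dots> = (\<Prod>i\<in>(UNIV :: ('l \<times> 'd) set). if fst i = k then 4 * r else 2 * R)"
      by (intro prod.cong) (auto simp: lo_def hi_def)
    finally show ?thesis by (simp add: prod.If_cases card Collect_neg_eq)
  qed
  have "measure lebesgue ?W \<le> measure lebesgue (\<Union>j\<in>{-N..N}. cbox (lo j) (hi j))"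
  proof (rule measure_mono_fmeasurable[OF cover])
    have "?W = cball 0 R \<inter> {x. infdist (block k x) L \<le> r}" by auto
    then have "closed ?W" by (simp add: closed_block_cylinder closed_Int)
    then show "?W \<in> sets lebesgue" by auto
  qed (auto intro: fmeasurable.finite_UN)
  also have "\<dots> \<le> (\<Sum>j\<in>{-N..N}. measure lebesgue (cbox (lo j) (hi j)))"
    by (rule measure_UNION_le) auto
  also have "\<dots> = real (card {-N..N}) * ((4 * r) ^ CARD('d) * (2 * R) ^ card {i::'l \<times> 'd. fst i \<noteq> k})"
    by (simp add: box)
  \<comment> \<open>The number of boxes is O(\<open>1 / r\<close>), which costs one of the
    \<open>CARD('d)\<close> powers of \<open>r\<close> in the volume of a box. Absorbing the
    rounding term 3 into the fraction uses \<open>r \<le> 1\<close>.\<close>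
  also have "\<dots> \<le> ((2 * R + 5) / r) * ((4 * r) ^ CARD('d) * (2 * R) ^ card {i::'l \<times> 'd. fst i \<noteq> k})"
  proof (rule mult_right_mono)
    have "0 \<le> (R + 1) / r" using r assms(5) by simp
    then have "N \<ge> 0" unfolding N_def by linarith
    then have "real (card {-N..N}) = 2 * of_int N + 1" by simp
    also have "\<dots> \<le> 2 * ((R + 1) / r) + 3" unfolding N_def by linarith
    also have "\<dots> \<le> (2 * R + 5) / r" using r by (simp add: field_simps)
    finally show "real (card {-N..N}) \<le> (2 * R + 5) / r" .
  qed (use r assms(5) in simp)
  also have "\<dots> = (2 * R + 5) * 4 ^ CARD('d) * (2 * R) ^ card {i::'l \<times> 'd. fst i \<noteq> k} * r ^ (CARD('d) - 1)"
    using r by (simp add: power_mult_distrib power_eq_if[of r "CARD('d)"])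
  finally show ?thesis .
qed

text \<open>For \<open>r \<le> 1\<close> the box count applies; for larger \<open>r\<close> the
  volume of the ball of radius \<open>R\<close> suffices. The constant is uniform in the axis
  \<open>L\<close>, and its summand 1 secures positivity.\<close>

lemma measure_block_cylinder_le_min:
  fixes k :: "'l::finite"
  assumes "0 \<le> R"
  obtains C where "C > 0" "\<And>r (L :: (real^'d::finite) set). 0 < r \<Longrightarrow> subspace L \<Longrightarrow> dim L = 1 \<Longrightarrow>
    measure lebesgue {x. norm x \<le> R \<and> infdist (block k x) L \<le> r} \<le> C * min 1 (r ^ (CARD('d) - 1))"
proof -
  define C1 where "C1 = (2 * R + 5) * 4 ^ CARD('d) * (2 * R) ^ card {i::'l \<times> 'd. fst i \<noteq> k}"
  define C2 where "C2 = measure lebesgue (cball 0 R :: (real^('l \<times> 'd)) set)"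
  have C: "C1 \<ge> 0" "C2 \<ge> 0" using assms by (auto simp: C1_def C2_def)
  show thesis
  proof (rule that[of "C1 + C2 + 1"])
    fix r :: real and L :: "(real^'d) set" assume *: "0 < r" "subspace L" "dim L = 1"
    let ?W = "{x. norm x \<le> R \<and> infdist (block k x) L \<le> r}"
    show "measure lebesgue ?W \<le> (C1 + C2 + 1) * min 1 (r ^ (CARD('d) - 1))"
    proof (cases "r \<le> 1")
      case True
      then have "measure lebesgue ?W \<le> C1 * r ^ (CARD('d) - 1)"
        unfolding C1_def using * assms by (intro measure_block_cylinder_le)
      also have "\<dots> \<le> (C1 + C2 + 1) * r ^ (CARD('d) - 1)"
        using C * by (intro mult_right_mono) auto
      also have "r ^ (CARD('d) - 1) = min 1 (r ^ (CARD('d) - 1))"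
        using True * power_le_one[of r "CARD('d) - 1"] by simp
      finally show ?thesis .
    next
      case False
      have eq: "?W = cball 0 R \<inter> {x. infdist (block k x) L \<le> r}" by auto
      then have "closed ?W" by (simp add: closed_block_cylinder closed_Int)
      then have "measure lebesgue ?W \<le> C2"
        unfolding C2_def by (intro measure_mono_fmeasurable) auto
      with False C show ?thesis by (simp add: min_absorb1)
    qed
  qed (use C in simp)
qed

section \<open>Quadratic forms\<close>

text \<open>\<open>m\<close> is the minimum of the form on the compact unit sphere; homogeneity
  extends the bound to all vectors. It makes the sublevel sets bounded.\<close>

lemma positive_definite_lower_bound:
  fixes A :: "real^'n^'n"
  assumes "positive_definite A"
  obtains m where "m > 0" "\<And>x. m * (norm x)\<^sup>2 \<le> x \<bullet> (A *v x)"
proof -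
  have cont: "continuous_on (sphere 0 1) (\<lambda>x. x \<bullet> (A *v x))"
    by (intro continuous_intros linear_continuous_on matrix_vector_mul_bounded_linear)
  have "sphere 0 1 \<noteq> ({} :: (real^'n) set)" by simp
  then obtain u :: "real^'n" where u: "norm u = 1"
    "\<And>y. norm y = 1 \<Longrightarrow> u \<bullet> (A *v u) \<le> y \<bullet> (A *v y)"
    using continuous_attains_inf[OF compact_sphere _ cont] by auto
  show thesis
  proof
    have "u \<noteq> 0" using u(1) by auto
    then show "0 < u \<bullet> (A *v u)" using assms by (simp add: positive_definite_def)
    fix x :: "real^'n"
    show "u \<bullet> (A *v u) * (norm x)\<^sup>2 \<le> x \<bullet> (A *v x)"
    proof (cases "x = 0")
      case False
      then have "u \<bullet> (A *v u) \<le> (x /\<^sub>R norm x) \<bullet> (A *v (x /\<^sub>R norm x))" by (intro u(2)) simp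
      also have "\<dots> = (x \<bullet> (A *v x)) / (norm x)\<^sup>2"
        by (simp add: matrix_vector_mult_scaleR power2_eq_square divide_simps)
      finally show ?thesis using False by (simp add: pos_le_divide_eq)
    qed simp
  qed
qed

text \<open>Changing one argument of the bilinear form at a time gives a Lipschitz bound on bounded
  sets. It places the \<open>\<epsilon>\<close>-neighbourhood of the ellipsoid in a shell of width
  O(\<open>\<epsilon>\<close>).\<close>

lemma quadratic_form_diff_bound:
  fixes A :: "real^'n^'n"
  obtains K where "K > 0"
    "\<And>x y. \<bar>y \<bullet> (A *v y) - x \<bullet> (A *v x)\<bar> \<le> K * (norm x + norm y) * dist x y"
proof -
  obtain K where K: "K > 0" "\<And>x. norm (A *v x) \<le> norm x * K"
    using bounded_linear.pos_bounded[OF matrix_vector_mul_bounded_linear[of A]] by blast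
  show thesis
  proof (rule that[OF K(1)])
    fix x y
    have "y \<bullet> (A *v y) - x \<bullet> (A *v x) = (y - x) \<bullet> (A *v y) + x \<bullet> (A *v (y - x))"
      by (simp add: matrix_vector_mult_diff_distrib inner_diff_left inner_diff_right)
    also have "\<bar>\<dots>\<bar> \<le> norm (y - x) * norm (A *v y) + norm x * norm (A *v (y - x))"
      by (meson Cauchy_Schwarz_ineq2 abs_triangle_ineq add_mono order_trans)
    also have "\<dots> \<le> norm (y - x) * (norm y * K) + norm x * (norm (y - x) * K)"
      by (intro add_mono mult_left_mono K) auto
    also have "\<dots> = K * (norm x + norm y) * dist x y"
      by (simp add: dist_norm norm_minus_commute algebra_simps)
    finally show "\<bar>y \<bullet> (A *v y) - x \<bullet> (A *v x)\<bar> \<le> K * (norm x + norm y) * dist x y" .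
  qed
qed

section \<open>Ellipsoids over cylinders\<close>

lemma hausdorff_measure_ellipsoid_cylinder_le:
  fixes A :: "real^('l::finite \<times> 'd::finite)^('l \<times> 'd)" and k :: 'l
  assumes "positive_definite A" "0 < c"
  obtains C where "C > 0" "\<And>\<rho> K. 0 < \<rho> \<Longrightarrow> cylinder \<rho> K \<Longrightarrow>
    hausdorff_measure (CARD('l) * CARD('d) - 1) ({x. x \<bullet> (A *v x) = c} \<inter> block_product k K)
      \<le> ennreal (C * min 1 (\<rho> ^ (CARD('d) - 1)))"
proof -
  define Q where "Q x = x \<bullet> (A *v x)" for x
  obtain m where m: "m > 0" "\<And>x. m * (norm x)\<^sup>2 \<le> Q x"
    unfolding Q_def by (rule positive_definite_lower_bound[OF assms(1)]) blast
  obtain K where K: "K > 0" "\<And>x y. \<bar>Q y - Q x\<bar> \<le> K * (norm x + norm y) * dist x y"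
    unfolding Q_def by (rule quadratic_form_diff_bound[of A]) blast
  have cont: "continuous_on UNIV Q"
    unfolding Q_def by (intro continuous_intros linear_continuous_on matrix_vector_mul_bounded_linear)
  have hom: "Q (t *\<^sub>R x) = t\<^sup>2 * Q x" for t x
    by (simp add: Q_def matrix_vector_mult_scaleR power2_eq_square)
  have norm_le: "norm x \<le> sqrt (s / m)" if "Q x \<le> s" for x s
    using m(1) order_trans[OF m(2) that]
    by (intro real_le_rsqrt) (simp add: pos_le_divide_eq mult.commute)
  have bdd: "bounded {x. Q x \<le> s}" for s
    using norm_le by (intro boundedI[of _ "sqrt (s / m)"]) auto
  \<comment> \<open>The solid ellipsoid \<open>Q x \<le> c\<close> lies in the ball of radius
    \<open>R\<close>.\<close>
  define R where "R = sqrt (c / m)"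
  have R: "R \<ge> 0" using assms(2) m(1) by (simp add: R_def)
  obtain C1 where C1: "C1 > 0" "\<And>r (L :: (real^'d) set). 0 < r \<Longrightarrow> subspace L \<Longrightarrow> dim L = 1 \<Longrightarrow>
    measure lebesgue {x. norm x \<le> R \<and> infdist (block k x) L \<le> r} \<le> C1 * min 1 (r ^ (CARD('d) - 1))"
    by (rule measure_block_cylinder_le_min[OF R, of k]) blast
  \<comment> \<open>A Lipschitz constant for \<open>Q\<close> between a point of the ellipsoid, of
    norm at most \<open>R\<close>, and a point within distance 1 of it, of norm at most
    \<open>R + 1\<close>.\<close>
  define M where "M = K * (2 * R + 1)"
  have M: "M > 0" using K R by (simp add: M_def)
  let ?n = "DIM(real^('l \<times> 'd))"
  define D where "D = 2 ^ ?n * unit_ball_vol (real (?n - 1)) / unit_ball_vol (real ?n)"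
  have D: "D > 0" unfolding D_def
    by (intro divide_pos_pos mult_pos_pos zero_less_power unit_ball_vol_pos of_nat_0_le_iff) simp
  \<comment> \<open>The factor \<open>8 * M\<close> is \<open>4 * h / \<epsilon>\<close> for the
    half-width \<open>h = 2 * M * \<epsilon>\<close> of the shell; the power of 2 pays for doubling
    the radius of the cylinder.\<close>
  define P where "P = 3 ^ ?n * (8 * M / c) * C1 * 2 ^ (CARD('d) - 1)"
  have P: "P > 0" using M assms(2) C1 by (simp add: P_def)
  show thesis
  proof (rule that[of "D * P"])
    show "D * P > 0" using D P by simp
    fix \<rho> :: real and K' :: "(real^'d) set" assume \<rho>: "0 < \<rho>" and "cylinder \<rho> K'"
    then obtain L where L: "subspace L" "dim L = 1" "K' = {x. infdist x L \<le> \<rho>}"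
      by (auto simp: cylinder_def)
    define S where "S = {x. infdist (block k x) L \<le> 2 * \<rho>}"
    have S: "closed S" "\<And>t x. x \<in> S \<Longrightarrow> 0 \<le> t \<Longrightarrow> t \<le> 1 \<Longrightarrow> t *\<^sub>R x \<in> S"
      using infdist_subspace_scaleR_le[OF L(1)] closed_block_cylinder
      by (auto simp: S_def linear_scale[OF linear_block] intro: order_trans)
    \<comment> \<open>The bound 1 controls the norms of neighbouring points, \<open>\<rho>\<close>
      keeps them in the cylinder of radius \<open>2 * \<rho>\<close>, and \<open>c / (8 * M)\<close>
      gives the condition \<open>4 * h \<le> c\<close> on the shell.\<close>
    define \<epsilon>\<^sub>0 where "\<epsilon>\<^sub>0 = min (min 1 \<rho>) (c / (8 * M))"
    have \<epsilon>\<^sub>0: "0 < \<epsilon>\<^sub>0" using \<rho> M assms(2) by (simp add: \<epsilon>\<^sub>0_def)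
    have "hausdorff_measure (?n - 1) ({x. Q x = c} \<inter> block_product k K')
      \<le> ennreal (D * (P * min 1 (\<rho> ^ (CARD('d) - 1))))"
      unfolding D_def
    proof (rule hausdorff_measure_le_neighbourhood_volume[OF \<epsilon>\<^sub>0])
      fix \<epsilon> assume "0 < \<epsilon>" "\<epsilon> \<le> \<epsilon>\<^sub>0"
      then have \<epsilon>: "0 < \<epsilon>" "\<epsilon> \<le> 1" "\<epsilon> \<le> \<rho>" "8 * M * \<epsilon> \<le> c"
        using M by (auto simp: \<epsilon>\<^sub>0_def field_simps)
      \<comment> \<open>Neighbouring points satisfy
        \<open>\<bar>Q y - c\<bar> \<le> M * \<epsilon>\<close>; twice that half-width leaves room
        for the strict lower inequality.\<close>
      define T where "T = {x \<in> S. c - 2 * M * \<epsilon> < Q x \<and> Q x \<le> c + 2 * M * \<epsilon>}"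
      have sub: "cball x \<epsilon> \<subseteq> T" if x: "x \<in> {x. Q x = c} \<inter> block_product k K'" for x
      proof
        fix y assume "y \<in> cball x \<epsilon>"
        then have y: "dist x y \<le> \<epsilon>" by simp
        have "infdist (block k x) L \<le> \<rho>" using x L by (simp add: block_product_def)
        then have "y \<in> S"
          using infdist_triangle[of "block k y" L "block k x"] dist_block_le[of k y x] y \<epsilon>
          by (simp add: S_def dist_commute)
        moreover have "norm x \<le> R" using x norm_le[of x c] by (simp add: R_def)
        moreover from this have "norm y \<le> R + 1"
          using norm_triangle_sub[of y x] y \<epsilon> by (simp add: dist_norm norm_minus_commute)
        ultimately have "K * (norm x + norm y) * dist x y \<le> K * (2 * R + 1) * \<epsilon>"
          using K(1) R \<epsilon> y by (intro mult_mono) auto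
        then have "\<bar>Q y - c\<bar> \<le> M * \<epsilon>"
          using K(2)[of y x] x by (simp add: M_def)
        moreover have "M * \<epsilon> > 0" using M \<epsilon> by simp
        ultimately show "y \<in> T" using \<open>y \<in> S\<close> by (auto simp: T_def abs_le_iff)
      qed
      have h: "0 < 2 * M * \<epsilon>" "4 * (2 * M * \<epsilon>) \<le> c" using M \<epsilon> by auto
      have T: "T \<in> lmeasurable"
        "measure lebesgue T \<le> 3 ^ ?n * (4 * (2 * M * \<epsilon>) / c) * measure lebesgue {x \<in> S. Q x \<le> c}"
        unfolding T_def using measure_shell_le[OF cont hom bdd S h] by auto
      have "measure lebesgue {x \<in> S. Q x \<le> c}
        \<le> measure lebesgue {x. norm x \<le> R \<and> infdist (block k x) L \<le> 2 * \<rho>}"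
      proof (rule measure_mono_fmeasurable)
        show "{x \<in> S. Q x \<le> c} \<subseteq> {x. norm x \<le> R \<and> infdist (block k x) L \<le> 2 * \<rho>}"
          using norm_le by (auto simp: S_def R_def)
        have "closed {x. Q x \<le> c}" using cont by (intro closed_Collect_le) auto
        with S(1) have "closed {x \<in> S. Q x \<le> c}" by (simp add: Collect_conj_eq closed_Int)
        then show "{x \<in> S. Q x \<le> c} \<in> sets lebesgue" by auto
        have "{x. norm x \<le> R \<and> infdist (block k x) L \<le> 2 * \<rho>} = cball 0 R \<inter> S"
          by (auto simp: S_def)
        then show "{x. norm x \<le> R \<and> infdist (block k x) L \<le> 2 * \<rho>} \<in> lmeasurable"
          using S(1) by (simp add: compact_Int_closed lmeasurable_compact)
      qed
      also have "\<dots> \<le> C1 * min 1 ((2 * \<rho>) ^ (CARD('d) - 1))"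
        using \<rho> L by (intro C1) auto
      also have "\<dots> \<le> C1 * (2 ^ (CARD('d) - 1) * min 1 (\<rho> ^ (CARD('d) - 1)))"
        using C1(1)
        by (intro mult_left_mono)
          (auto simp: power_mult_distrib min_mult_distrib_left intro: min.coboundedI1)
      finally have "measure lebesgue {x \<in> S. Q x \<le> c}
        \<le> C1 * (2 ^ (CARD('d) - 1) * min 1 (\<rho> ^ (CARD('d) - 1)))" .
      then have "3 ^ ?n * (4 * (2 * M * \<epsilon>) / c) * measure lebesgue {x \<in> S. Q x \<le> c}
        \<le> 3 ^ ?n * (4 * (2 * M * \<epsilon>) / c) * (C1 * (2 ^ (CARD('d) - 1) * min 1 (\<rho> ^ (CARD('d) - 1))))"
        using h assms(2) by (intro mult_left_mono) auto
      also have "\<dots> = P * min 1 (\<rho> ^ (CARD('d) - 1)) * \<epsilon>"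
        by (simp add: P_def)
      finally show "\<exists>T\<in>lmeasurable. (\<forall>x\<in>{x. Q x = c} \<inter> block_product k K'. cball x \<epsilon> \<subseteq> T) \<and>
          measure lebesgue T \<le> P * min 1 (\<rho> ^ (CARD('d) - 1)) * \<epsilon>"
        using T sub by (intro bexI[of _ T]) auto
    qed
    then show "hausdorff_measure (CARD('l) * CARD('d) - 1) ({x. x \<bullet> (A *v x) = c} \<inter> block_product k K')
      \<le> ennreal (D * P * min 1 (\<rho> ^ (CARD('d) - 1)))"
      by (simp add: Q_def mult.assoc)
  qed
qed

section \<open>From cylinders to balls, and the final exponent\<close>

text \<open>The origin lies on the axis of any such cylinder, so the span of a basis vector will do
  as the axis. This reduces the claim for balls to that for cylinders.\<close>

lemma ex_cylinder_superset_cball: "\<exists>K :: 'a::euclidean_space set. cylinder \<rho> K \<and> cball 0 \<rho> \<subseteq> K"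
proof -
  obtain v :: 'a where v: "v \<in> Basis" using nonempty_Basis by blast
  then have "dim (span {v}) = 1" by (simp add: dim_insert span_empty nonzero_Basis)
  then have "cylinder \<rho> {x. infdist x (span {v}) \<le> \<rho>}"
    unfolding cylinder_def using subspace_span by blast
  moreover have "cball 0 \<rho> \<subseteq> {x. infdist x (span {v}) \<le> \<rho>}"
    by (auto intro: infdist_le2[OF span_zero] simp: dist_commute)
  ultimately show ?thesis by blast
qed

theorem lemma7p13:
  fixes E :: "(real^('l::finite \<times> 'd::finite)) set" and k :: 'l
  assumes "CARD('d) \<ge> 2" and "block_ellipsoid E"
  shows "(\<exists>C>0. \<forall>\<rho>>0. \<forall>K. cylinder \<rho> K \<longrightarrow>
            hausdorff_measure (CARD('l) * CARD('d) - 1) (E \<inter> block_product k K)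
              \<le> ennreal (C * min 1 (\<rho> powr ((real CARD('d) - 1) / 2)))) \<and>
         (\<exists>C>0. \<forall>\<rho>>0.
            hausdorff_measure (CARD('l) * CARD('d) - 1) (E \<inter> block_product k (cball 0 \<rho>))
              \<le> ennreal (C * min 1 (\<rho> powr ((real CARD('d) - 1) / 2))))"
proof -
  obtain A c where E: "c > 0" "positive_definite A" "E = {x. x \<bullet> (A *v x) = c}"
    using assms(2) unfolding block_ellipsoid_def by blast
  obtain C where C: "C > 0" "\<And>\<rho> K. 0 < \<rho> \<Longrightarrow> cylinder \<rho> K \<Longrightarrow>
    hausdorff_measure (CARD('l) * CARD('d) - 1) (E \<inter> block_product k K)
      \<le> ennreal (C * min 1 (\<rho> ^ (CARD('d) - 1)))"
    unfolding E(3) by (rule hausdorff_measure_ellipsoid_cylinder_le[OF E(2,1), of k]) blast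
  \<comment> \<open>The exponent obtained so far is \<open>CARD('d) - 1\<close>, twice the one
    claimed. For \<open>\<rho> \<le> 1\<close> halving the exponent only enlarges the power; for
    \<open>\<rho> > 1\<close> the right-hand side is 1.\<close>
  have pow: "min 1 (\<rho> ^ (CARD('d) - 1)) \<le> min 1 (\<rho> powr ((real CARD('d) - 1) / 2))"
    if "0 < \<rho>" for \<rho> :: real
  proof (cases "\<rho> \<le> 1")
    case True
    have "\<rho> ^ (CARD('d) - 1) = \<rho> powr (real CARD('d) - 1)"
      using that assms(1) by (simp add: of_nat_diff flip: powr_realpow)
    also have "\<dots> \<le> \<rho> powr ((real CARD('d) - 1) / 2)"
      using that True assms(1) by (intro powr_mono') auto
    finally show ?thesis by (rule min.mono[OF order_refl])
  next
    case False
    then have "1 \<le> \<rho> powr ((real CARD('d) - 1) / 2)"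
      using assms(1) by (intro ge_one_powr_ge_zero) auto
    then show ?thesis by (simp add: min_def)
  qed
  have cyl: "hausdorff_measure (CARD('l) * CARD('d) - 1) (E \<inter> block_product k K)
      \<le> ennreal (C * min 1 (\<rho> powr ((real CARD('d) - 1) / 2)))"
    if "0 < \<rho>" "cylinder \<rho> K" for \<rho> K
    using C(2)[OF that] 
    by (rule order_trans)
      (use C(1) pow[OF that(1)] in \<open>auto intro!: ennreal_leI mult_left_mono\<close>)
  have "hausdorff_measure (CARD('l) * CARD('d) - 1) (E \<inter> block_product k (cball 0 \<rho>))
      \<le> ennreal (C * min 1 (\<rho> powr ((real CARD('d) - 1) / 2)))"
    if "0 < \<rho>" for \<rho>
  proof -
    obtain K :: "(real^'d) set" where K: "cylinder \<rho> K" "cball 0 \<rho> \<subseteq> K"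
      using ex_cylinder_superset_cball by blast
    have "hausdorff_measure (CARD('l) * CARD('d) - 1) (E \<inter> block_product k (cball 0 \<rho>))
        \<le> hausdorff_measure (CARD('l) * CARD('d) - 1) (E \<inter> block_product k K)"
      by (rule hausdorff_measure_mono) (use K in \<open>auto simp: block_product_def\<close>)
    also note cyl[OF that K(1)]
    finally show ?thesis .
  qed
  with cyl C(1) show ?thesis by blast
qed

end
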